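(* Let $\mathcal{A}$ be a central S-ring over a finite group $G$, and let $m$ be an integer coprime to $|G|$. Then for every basic set $X$ of $\mathcal{A}$, the set $X^{(m)}=\{x^m : x\in X\}$ is again a basic set of $\mathcal{A}$ (so $\sigma_m(\mathcal{A})=\mathcal{A}$). Moreover, the $\mathbb{Z}$-linear map $\mathcal{A}\to\mathcal{A}$ determined by $\underline{X}\mapsto\underline{X^{(m)}}$ for all basic sets $X$ is a ring automorphism of $\mathcal{A}$.
   Context: For a finite group $G$ with identity $e$ and $X\subseteq G$, write $\underline{X}=\sum_{x\in X}x\in\mathbb{Z}G$. A subring $\mathcal{A}$ of the group ring $\mathbb{Z}G$ is an S-ring (Schur ring) over $G$ if there is a partition $\mathcal{S}(\mathcal{A})$ of $G$ such that (S1) $\{e\}\in\mathcal{S}(\mathcal{A})$; (S2) $X\in\mathcal{S}(\mathcal{A})\Rightarrow X^{-1}\in\mathcal{S}(\mathcal{A})$; (S3) $\mathcal{A}$ is the $\mathbb{Z}$-span of $\{\underline{X}: X\in\mathcal{S}(\mathcal{A})\}$. The elements of $\mathcal{S}(\mathcal{A})$ are the basic sets. An S-ring is central if it is contained in the center $\mathcal{Z}(\mathbb{Z}G)$ of $\mathbb{Z}G$. For an integer $m$ coprime to $|G|$, $\sigma_m:G\to G$, $x\mapsto x^m$, and for $X\subseteq G$, $X^{(m)}=\{x^m: x\in X\}$. *)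

theory Defs
  imports "HOL-Algebra.Group"
begin

definition group_ring :: "('a, 'b) monoid_scheme \<Rightarrow> ('a \<Rightarrow> int) set" where
  "group_ring G = {f. \<forall>g. g \<notin> carrier G \<longrightarrow> f g = 0}"

definition gr_mult :: "('a, 'b) monoid_scheme \<Rightarrow> ('a \<Rightarrow> int) \<Rightarrow> ('a \<Rightarrow> int) \<Rightarrow> ('a \<Rightarrow> int)" where
  "gr_mult G f h = (\<lambda>g. if g \<in> carrier G
      then (\<Sum>x\<in>carrier G. f x * h (inv\<^bsub>G\<^esub> x \<otimes>\<^bsub>G\<^esub> g)) else 0)"

text \<open>Underline X = sum of the elements of X, as an element of ZG.\<close>
definition ul :: "'a set \<Rightarrow> ('a \<Rightarrow> int)" where
  "ul X = (\<lambda>g. if g \<in> X then 1 else 0)"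

definition zspan :: "'a set set \<Rightarrow> ('a \<Rightarrow> int) set" where
  "zspan S = {f. \<exists>c :: 'a set \<Rightarrow> int. f = (\<lambda>g. \<Sum>X\<in>S. c X * ul X g)}"

text \<open>S is the set of basic sets of an S-ring over G: a partition of G satisfying
  (S1), (S2), and whose Z-span (S3) is a subring of ZG.\<close>
definition schur_partition :: "('a, 'b) monoid_scheme \<Rightarrow> 'a set set \<Rightarrow> bool" where
  "schur_partition G S \<longleftrightarrow>
     (\<Union>S = carrier G) \<and> {} \<notin> S \<and> (\<forall>X\<in>S. \<forall>Y\<in>S. X \<noteq> Y \<longrightarrow> X \<inter> Y = {}) \<and>
     {\<one>\<^bsub>G\<^esub>} \<in> S \<and>
     (\<forall>X\<in>S. (\<lambda>x. inv\<^bsub>G\<^esub> x) ` X \<in> S) \<and>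
     ul {\<one>\<^bsub>G\<^esub>} \<in> zspan S \<and>
     (\<forall>a\<in>zspan S. \<forall>b\<in>zspan S. (\<lambda>g. a g + b g) \<in> zspan S \<and> (\<lambda>g. - a g) \<in> zspan S
        \<and> gr_mult G a b \<in> zspan S)"

definition central_sring :: "('a, 'b) monoid_scheme \<Rightarrow> 'a set set \<Rightarrow> bool" where
  "central_sring G S \<longleftrightarrow>
     (\<forall>a\<in>zspan S. \<forall>f\<in>group_ring G. gr_mult G a f = gr_mult G f a)"

end

theory Submission
  imports Defs "HOL-Number_Theory.Residues"
begin

text \<open>Let \<open>n = |G|\<close>. For a class function \<open>a\<close> on \<open>G\<close> and a prime \<open>p\<close> not dividing \<open>n\<close>, the
  convolution power satisfies \<open>a^p (g^p) = a g\<close> modulo \<open>p\<close>: expand \<open>a^p\<close> over \<open>p\<close>-tuples, pair with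
  a class function and rotate the tuples. Hence if \<open>p v = 1\<close> modulo \<open>n\<close>, the pullback of \<open>a\<close> along
  \<open>g \<mapsto> g^v\<close> is congruent to \<open>a^p\<close> modulo \<open>p\<close>. As \<open>a \<mapsto> a^p\<close> is multiplicative on class functions and
  preserves the S-ring, the pullback does both modulo \<open>p\<close>, and exactly once \<open>p\<close> is large compared
  with the values of the functions involved. Finally every residue prime to \<open>n\<close> is represented by
  an integer all of whose prime factors are large, so Dirichlet's theorem is not needed. A power
  map thus acts on the S-ring, and so does the inverse power map, which forces it to permute the
  basic sets.\<close>

section \<open>Congruences and large primes\<close>

text \<open>Take \<open>M = m + k * n\<close> with \<open>k\<close> the product of the primes up to
  \<open>K\<close> that do not divide \<open>m\<close>. Such a small prime divides exactly one of
  \<open>m\<close> and \<open>k * n\<close>: if it divides \<open>m\<close>, it divides neither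
  \<open>k\<close> nor, by coprimality, \<open>n\<close>. Hence it does not divide the sum.\<close>

lemma coprime_shift_no_small_prime:
  fixes m n K :: nat
  assumes "coprime m n" "n > 0"
  obtains M where "M > 0" "[M = m] (mod n)" "\<And>p. prime p \<Longrightarrow> p dvd M \<Longrightarrow> K < p"
proof -
  define P where "P = {p. prime p \<and> p \<le> K \<and> \<not> p dvd m}"
  have fin: "finite P"
    by (rule finite_subset[of _ "{..K}"]) (auto simp: P_def)
  define k where "k = \<Prod>P"
  have dvdk: "p dvd k \<longleftrightarrow> \<not> p dvd m" if "prime p" "p \<le> K" for p
  proof -
    have "p dvd k \<longleftrightarrow> (\<exists>q\<in>P. p dvd q)"
      unfolding k_def using prime_dvd_prod_iff[OF fin that(1), of "\<lambda>x. x"] by simp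
    also have "\<dots> \<longleftrightarrow> p \<in> P"
      using that by (auto simp: P_def dest: primes_dvd_imp_eq)
    finally show ?thesis using that by (simp add: P_def)
  qed
  have "k > 0" unfolding k_def by (rule prod_pos) (auto simp: P_def prime_gt_0_nat)
  show thesis
  proof
    show "m + k * n > 0" using \<open>k > 0\<close> assms(2) by simp
    show "[m + k * n = m] (mod n)" by (simp add: cong_def)
    fix p :: nat assume p: "prime p" "p dvd m + k * n"
    show "K < p"
    proof (rule ccontr)
      assume "\<not> K < p"
      hence *: "p dvd k \<longleftrightarrow> \<not> p dvd m" using dvdk p by simp
      show False
      proof (cases "p dvd m")
        case True
        hence "p dvd k * n" using p(2) by (simp add: dvd_add_right_iff)
        hence "p dvd n" using True * p(1) by (simp add: prime_dvd_mult_iff)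
        with True assms(1) p(1) show False
          by (meson coprime_common_divisor not_prime_unit)
      next
        case False
        hence "p dvd k * n" using * by simp
        with p(2) False show False by (simp add: dvd_add_left_iff)
      qed
    qed
  qed
qed

lemma fermat_int:
  fixes a :: int
  assumes "prime p"
  shows "[a ^ p = a] (mod int p)"
proof -
  define b where "b = nat (a mod int p)"
  have p0: "p > 0" using assms prime_gt_0_nat by blast
  have b: "[a = int b] (mod int p)"
    using p0 by (simp add: b_def cong_def)
  have "[b ^ p = b] (mod p)"
  proof (cases "p dvd b")
    case True
    then show ?thesis using p0 by (simp add: cong_def mod_eq_0_iff_dvd dvd_trans[OF _ dvd_power])
  next
    case False
    hence "[b * b ^ (p - 1) = b * 1] (mod p)"
      using fermat_theorem[OF assms] by (intro cong_mult) auto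
    thus ?thesis using p0 by (simp flip: power_Suc)
  qed
  hence "[int b ^ p = int b] (mod int p)"
    using cong_int_iff[of "b ^ p" b p] by simp
  with b show ?thesis by (meson cong_pow cong_sym cong_trans)
qed

text \<open>A nonzero multiple of \<open>k\<close> is too large to be the difference of
  \<open>x\<close> and \<open>y\<close>. This turns congruences modulo large primes into
  equalities.\<close>

lemma cong_imp_eq_of_abs_less:
  fixes x y :: int
  assumes "[x = y] (mod k)" "\<bar>x\<bar> \<le> B" "\<bar>y\<bar> \<le> B" "2 * B < k"
  shows "x = y"
proof (rule ccontr)
  assume "x \<noteq> y"
  moreover have "k dvd x - y" using assms(1) by (simp add: cong_iff_dvd_diff)
  ultimately have "\<bar>k\<bar> \<le> \<bar>x - y\<bar>" by (intro dvd_imp_le_int) auto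
  with assms show False by linarith
qed

section \<open>Orbit counting modulo a prime\<close>

text \<open>The orbits of \<open>U\<close> on \<open>M\<close> have length 1 or \<open>p\<close>,
  and \<open>w\<close> is constant on each, so an orbit of length \<open>p\<close> contributes a
  multiple of \<open>p\<close>. The induction removes one such orbit at a time.\<close>

lemma sum_cong_fixed_points_mod_prime:
  fixes w :: "'c \<Rightarrow> int"
  assumes "finite M" "prime p"
    and "\<And>x. x \<in> M \<Longrightarrow> U x \<in> M"
    and "\<And>x. x \<in> M \<Longrightarrow> (U ^^ p) x = x"
    and "\<And>x. x \<in> M \<Longrightarrow> w (U x) = w x"
  shows "[sum w M = sum w {x \<in> M. U x = x}] (mod int p)"
  using assms(1,3-5)
proof (induction M rule: finite_psubset_induct)
  case (psubset M)
  have it: "(U ^^ i) x \<in> M" "w ((U ^^ i) x) = w x" if "x \<in> M" for x i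
  proof -
    have "(U ^^ i) x \<in> M \<and> w ((U ^^ i) x) = w x"
      by (induction i) (use that psubset.prems in auto)
    thus "(U ^^ i) x \<in> M" "w ((U ^^ i) x) = w x" by auto
  qed
  have comp: "(U ^^ i) ((U ^^ j) y) = (U ^^ (i + j)) y" for i j y
    by (simp add: funpow_add)
  have iter: "(U ^^ (k * d)) y = y" if "(U ^^ d) y = y" for y k d
    by (induction k) (use that in \<open>auto simp: funpow_add\<close>)
  show ?case
  proof (cases "\<exists>x\<in>M. U x \<noteq> x")
    case False
    hence "{x \<in> M. U x = x} = M" by auto
    thus ?thesis by simp
  next
    case True
    then obtain x where x: "x \<in> M" "U x \<noteq> x" by blast
    have per: "(U ^^ (k * p)) x = x" for k using psubset.prems(2)[OF x(1)] by (rule iter)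
    have p1: "p > 1" using assms(2) prime_gt_1_nat by blast
    define Orb where "Orb = (\<lambda>i. (U ^^ i) x) ` {..<p}"
    have inO: "(U ^^ i) x \<in> Orb" for i
    proof -
      have "(U ^^ i) x = (U ^^ (i mod p)) ((U ^^ (i div p * p)) x)"
        by (simp add: comp)
      also have "\<dots> = (U ^^ (i mod p)) x" by (simp add: per)
      finally show ?thesis using p1 by (auto simp: Orb_def)
    qed
    \<comment> \<open>A period \<open>d\<close> prime to \<open>p\<close> combines with the period
      \<open>p\<close> through Bezout to give period 1, against the choice of
      \<open>x\<close>.\<close>
    have nofix: "(U ^^ d) x \<noteq> x" if d0: "0 < d" "d < p" for d
    proof
      assume d: "(U ^^ d) x = x"
      have "coprime d p" using that assms(2)
        by (metis coprime_commute nat_dvd_not_less prime_imp_coprime)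
      hence "gcd d p = 1" by simp
      then obtain s t where st: "d * s = p * t + 1"
        using bezout_nat[of d p] d0(1) by auto
      have "U x = (U ^^ (p * t + 1)) x"
        using per[of t] by (simp add: mult.commute)
      also have "\<dots> = x" using iter[OF d, of s] st by (simp add: mult.commute)
      finally show False using x(2) by simp
    qed
    have inj: "inj_on (\<lambda>i. (U ^^ i) x) {..<p}"
    proof (rule linorder_inj_onI)
      fix i j assume ij: "i < j" "i \<in> {..<p}" "j \<in> {..<p}"
      show "(U ^^ i) x \<noteq> (U ^^ j) x"
      proof
        assume "(U ^^ i) x = (U ^^ j) x"
        hence "(U ^^ (p - i)) ((U ^^ i) x) = (U ^^ (p - i)) ((U ^^ j) x)" by simp
        hence "(U ^^ p) x = (U ^^ (j - i + p)) x"
          using ij by (simp add: comp add.commute)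
        hence "x = (U ^^ (j - i)) x" using per[of 1] by (simp add: funpow_add)
        moreover have "0 < j - i" "j - i < p" using ij by auto
        ultimately show False using nofix by metis
      qed
    qed auto
    have OM: "Orb \<subseteq> M" using it(1)[OF x(1)] by (auto simp: Orb_def)
    have xO: "x \<in> Orb" using inO[of 0] by simp
    have sumO: "sum w Orb = int p * w x"
      unfolding Orb_def by (subst sum.reindex[OF inj]) (simp add: it(2)[OF x(1)])
    \<comment> \<open>The induction hypothesis needs \<open>M - Orb\<close> to be closed under
      \<open>U\<close>. A point sent into the orbit is recovered from its image by
      \<open>p - 1\<close> further steps, so it lies in the orbit itself.\<close>
    have backward: "y \<in> Orb" if "y \<in> M" "U y \<in> Orb" for y
    proof -
      from that(2) obtain i where i: "U y = (U ^^ i) x" by (auto simp: Orb_def)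
      have "y = (U ^^ (p - 1)) (U y)"
        using psubset.prems(2)[OF that(1)] p1
        by (metis Suc_pred' comp_apply funpow_Suc_right order.strict_trans zero_less_one)
      also have "\<dots> = (U ^^ (p - 1 + i)) x" by (simp add: i funpow_add)
      finally show ?thesis using inO by metis
    qed
    have fixO: "U y \<noteq> y" if "y \<in> Orb" for y
    proof
      assume y: "U y = y"
      from that obtain i where i: "i < p" "y = (U ^^ i) x" by (auto simp: Orb_def)
      have "x = (U ^^ (p - i)) y"
        using per[of 1] i by (simp add: comp)
      moreover have "(U ^^ k) y = y" for k using iter[of 1 y k] y by simp
      ultimately show False using y x(2) by simp
    qed
    have "[sum w (M - Orb) = sum w {y \<in> M - Orb. U y = y}] (mod int p)"
      by (rule psubset.IH) (use xO x(1) psubset.prems backward in auto)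
    moreover have "{y \<in> M - Orb. U y = y} = {y \<in> M. U y = y}" using fixO by auto
    moreover have "sum w M = sum w (M - Orb) + int p * w x"
      using sum.subset_diff[OF OM psubset.hyps, of w] sumO by simp
    ultimately show ?thesis by (simp add: cong_def)
  qed
qed

section \<open>Generating the units modulo n by inverses of large primes\<close>

text \<open>The inverse of \<open>u\<close> modulo \<open>n\<close> is represented by a number
  \<open>M\<close> all of whose prime factors exceed \<open>K\<close>. So \<open>u\<close> is,
  modulo \<open>n\<close>, a product of inverses of large primes, and these are the exponents for
  which congruences modulo \<open>p\<close> are available.\<close>

lemma large_prime_induct:
  fixes n K u :: nat
  assumes "n > 0" "coprime u n"
    and cong: "\<And>u v. [u = v] (mod n) \<Longrightarrow> Q u \<Longrightarrow> Q v"
    and one: "Q 1"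
    and mult: "\<And>u v. Q u \<Longrightarrow> Q v \<Longrightarrow> Q (u * v)"
    and prime: "\<And>p v. prime p \<Longrightarrow> K < p \<Longrightarrow> [p * v = 1] (mod n) \<Longrightarrow> Q v"
  shows "Q u"
proof -
  obtain w where w: "[u * w = 1] (mod n)"
    using cong_solve_coprime_nat[OF assms(2)] by auto
  hence "coprime w n"
    by (metis coprime_iff_invertible_nat mult.commute One_nat_def)
  then obtain M where M: "M > 0" "[M = w] (mod n)" "\<And>p. prime p \<Longrightarrow> p dvd M \<Longrightarrow> K < p"
    using coprime_shift_no_small_prime[of w n K] assms(1) by metis
  have "[M * u = 1] (mod n)"
    using cong_trans[OF cong_scalar_right[OF M(2)] w[unfolded mult.commute[of u]]] .
  with M(1,3) show "Q u"
  proof (induction M arbitrary: u rule: less_induct)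
    case (less M)
    show ?case
    proof (cases "M = 1")
      case True
      with less.prems(3) show ?thesis using cong[OF cong_sym one, of u] by (simp add: cong_sym_eq)
    next
      case False
      then obtain p where p: "prime p" "p dvd M" using prime_factor_nat by blast
      then obtain M' where M': "M = p * M'" by blast
      \<comment> \<open>With \<open>M = p * M'\<close>, the inverse of \<open>p\<close> is
        \<open>M' * u\<close> and the inverse of \<open>M'\<close> is \<open>p * u\<close>; their
        product is \<open>u\<close> modulo \<open>n\<close>.\<close>
      have "[p * (M' * u) = 1] (mod n)" using less.prems(3) by (simp add: M' mult.assoc)
      hence 1: "Q (M' * u)" using prime p less.prems(2) by blast
      have "M' < M" using M' less.prems(1) prime_gt_1_nat[OF p(1)] by simp
      moreover have "[M' * (p * u) = 1] (mod n)" using less.prems(3) by (simp add: M' ac_simps)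
      ultimately have "Q (p * u)" using less.IH[of M' "p * u"] less.prems(1,2) M' by simp
      hence "Q (M' * u * (p * u))" using 1 mult by blast
      moreover have "[M' * u * (p * u) = u] (mod n)"
        using cong_scalar_right[OF less.prems(3), of u] by (simp add: M' ac_simps)
      ultimately show ?thesis using cong by blast
    qed
  qed
qed

section \<open>Class functions under convolution\<close>

text \<open>Conjugation invariance in its cyclic form, which is what rotating the factors of a
  product uses. These functions form the center of the group ring.\<close>

definition class_functions :: "('a, 'b) monoid_scheme \<Rightarrow> ('a \<Rightarrow> int) set" where
  "class_functions G = {a \<in> group_ring G. \<forall>x\<in>carrier G. \<forall>y\<in>carrier G. a (x \<otimes>\<^bsub>G\<^esub> y) = a (y \<otimes>\<^bsub>G\<^esub> x)}"

text \<open>Packaging convolution as a monoid record gives access to \<open>[^]\<close> and to the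
  laws of powers in commutative monoids.\<close>

definition class_monoid :: "('a, 'b) monoid_scheme \<Rightarrow> ('a \<Rightarrow> int) monoid" where
  "class_monoid G = \<lparr>carrier = class_functions G, monoid.mult = gr_mult G, one = ul {\<one>\<^bsub>G\<^esub>}\<rparr>"

text \<open>The value 0 outside the carrier keeps the result in the group ring. On a function
  \<open>ul X\<close> this realizes the image of \<open>X\<close> under the power map inverse to the
  exponent \<open>v\<close>.\<close>

definition power_pullback :: "('a, 'b) monoid_scheme \<Rightarrow> nat \<Rightarrow> ('a \<Rightarrow> int) \<Rightarrow> ('a \<Rightarrow> int)" where
  "power_pullback G v a = (\<lambda>g. if g \<in> carrier G then a (g [^]\<^bsub>G\<^esub> v) else 0)"

locale fin_group = group +
  assumes fin [simp]: "finite (carrier G)"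
begin

lemma inv_l_cancel [simp]: "\<lbrakk>x \<in> carrier G; y \<in> carrier G\<rbrakk> \<Longrightarrow> inv x \<otimes> (x \<otimes> y) = y"
  and l_inv_cancel [simp]: "\<lbrakk>x \<in> carrier G; y \<in> carrier G\<rbrakk> \<Longrightarrow> x \<otimes> (inv x \<otimes> y) = y"
  by (simp_all flip: m_assoc)

lemma sum_translate:
  assumes "x \<in> carrier G"
  shows "(\<Sum>y\<in>carrier G. f (x \<otimes> y)) = (\<Sum>y\<in>carrier G. f y)"
  by (rule sum.reindex_bij_witness[where j = "\<lambda>y. x \<otimes> y" and i = "\<lambda>y. inv x \<otimes> y"])
    (use assms in auto)

lemma sum_translate_right:
  assumes "x \<in> carrier G"
  shows "(\<Sum>y\<in>carrier G. f (y \<otimes> x)) = (\<Sum>y\<in>carrier G. f y)"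
  by (rule sum.reindex_bij_witness[where j = "\<lambda>y. y \<otimes> x" and i = "\<lambda>y. y \<otimes> inv x"])
    (use assms in \<open>auto simp: m_assoc\<close>)

lemma sum_inverse: "(\<Sum>y\<in>carrier G. f (inv y)) = (\<Sum>y\<in>carrier G. f y)"
  by (rule sum.reindex_bij_witness[where j = "\<lambda>y. inv y" and i = "\<lambda>y. inv y"]) auto

text \<open>Substitute \<open>x \<otimes> y\<close> for \<open>g\<close>. Pairing with a test
  function \<open>b\<close> serves both associativity and the expansion of convolution
  powers.\<close>

lemma sum_gr_mult:
  "(\<Sum>g\<in>carrier G. gr_mult G f h g * b g) =
   (\<Sum>x\<in>carrier G. f x * (\<Sum>y\<in>carrier G. h y * b (x \<otimes> y)))"
proof -
  have "(\<Sum>g\<in>carrier G. gr_mult G f h g * b g) =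
        (\<Sum>g\<in>carrier G. \<Sum>x\<in>carrier G. f x * h (inv x \<otimes> g) * b g)"
    by (simp add: gr_mult_def sum_distrib_right)
  also have "\<dots> = (\<Sum>x\<in>carrier G. \<Sum>g\<in>carrier G. f x * h (inv x \<otimes> g) * b g)"
    by (rule sum.swap)
  also have "\<dots> = (\<Sum>x\<in>carrier G. \<Sum>y\<in>carrier G. f x * h y * b (x \<otimes> y))"
  proof (rule sum.cong[OF refl])
    fix x assume "x \<in> carrier G"
    thus "(\<Sum>g\<in>carrier G. f x * h (inv x \<otimes> g) * b g) = (\<Sum>y\<in>carrier G. f x * h y * b (x \<otimes> y))"
      using sum_translate[of x "\<lambda>g. f x * h (inv x \<otimes> g) * b g"] by simp
  qed
  finally show ?thesis by (simp add: sum_distrib_left mult.assoc)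
qed

lemma gr_mult_in_group_ring [simp]: "gr_mult G f h \<in> group_ring G"
  by (simp add: gr_mult_def group_ring_def)

lemma gr_mult_assoc: "gr_mult G (gr_mult G f h) k = gr_mult G f (gr_mult G h k)"
proof
  fix g
  show "gr_mult G (gr_mult G f h) k g = gr_mult G f (gr_mult G h k) g"
  proof (cases "g \<in> carrier G")
    case True
    have "gr_mult G (gr_mult G f h) k g =
      (\<Sum>x\<in>carrier G. gr_mult G f h x * k (inv x \<otimes> g))"
      using True by (simp add: gr_mult_def)
    also have "\<dots> = gr_mult G f (gr_mult G h k) g"
      using True
      by (subst sum_gr_mult) (auto simp: gr_mult_def inv_mult_group m_assoc intro!: sum.cong)
    finally show ?thesis .
  qed (simp add: gr_mult_def)
qed

lemma gr_mult_delta_left: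
  assumes "x \<in> carrier G" "g \<in> carrier G"
  shows "gr_mult G (ul {x}) f g = f (inv x \<otimes> g)"
proof -
  have "gr_mult G (ul {x}) f g = (\<Sum>y\<in>carrier G. if y = x then f (inv y \<otimes> g) else 0)"
  proof -
    have "ul {x} y * f (inv y \<otimes> g) = (if y = x then f (inv y \<otimes> g) else 0)" for y
      by (simp add: ul_def)
    thus ?thesis using assms(2) unfolding gr_mult_def by simp
  qed
  thus ?thesis using assms by simp
qed

lemma gr_mult_delta_right:
  assumes "x \<in> carrier G" "g \<in> carrier G"
  shows "gr_mult G f (ul {x}) g = f (g \<otimes> inv x)"
proof -
  have "gr_mult G f (ul {x}) g = (\<Sum>y\<in>carrier G. if y = g \<otimes> inv x then f y else 0)"
  proof -
    have "inv y \<otimes> g = x \<longleftrightarrow> y = g \<otimes> inv x" if "y \<in> carrier G" for y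
      using assms that inv_solve_left[of x y g] inv_solve_right[of y g x] by metis
    hence "f y * ul {x} (inv y \<otimes> g) = (if y = g \<otimes> inv x then f y else 0)" if "y \<in> carrier G" for y
      using that by (simp add: ul_def)
    thus ?thesis using assms(2) unfolding gr_mult_def by (simp cong: sum.cong)
  qed
  thus ?thesis using assms by simp
qed

section \<open>Class functions as the center of the group ring\<close>

lemma class_functions_iff_central:
  assumes "a \<in> group_ring G"
  shows "a \<in> class_functions G \<longleftrightarrow> (\<forall>f\<in>group_ring G. gr_mult G a f = gr_mult G f a)"
proof safe
  fix f assume a: "a \<in> class_functions G" and f: "f \<in> group_ring G"
  show "gr_mult G a f = gr_mult G f a"
  proof
    fix g
    show "gr_mult G a f g = gr_mult G f a g"
    proof (cases "g \<in> carrier G")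
      case True
      have "gr_mult G a f g = (\<Sum>x\<in>carrier G. a x * f (inv x \<otimes> g))"
        using True by (simp add: gr_mult_def)
      \<comment> \<open>Replace \<open>x\<close> by \<open>g \<otimes> inv x\<close>; the class
        property then turns \<open>a (g \<otimes> inv x)\<close> into
        \<open>a (inv x \<otimes> g)\<close>.\<close>
      also have "\<dots> = (\<Sum>x\<in>carrier G. a (g \<otimes> inv x) * f (inv (g \<otimes> inv x) \<otimes> g))"
        using True sum_translate[of g "\<lambda>x. a x * f (inv x \<otimes> g)"]
          sum_inverse[of "\<lambda>x. a (g \<otimes> x) * f (inv (g \<otimes> x) \<otimes> g)"] by simp
      also have "\<dots> = (\<Sum>x\<in>carrier G. f x * a (inv x \<otimes> g))"
        using True a by (auto simp: class_functions_def inv_mult_group m_assoc intro!: sum.cong)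
      finally show ?thesis using True by (simp add: gr_mult_def)
    qed (simp add: gr_mult_def)
  qed
next
  assume c: "\<forall>f\<in>group_ring G. gr_mult G a f = gr_mult G f a"
  show "a \<in> class_functions G"
    unfolding class_functions_def
  proof (safe intro!: assms)
    fix x y assume xy: "x \<in> carrier G" "y \<in> carrier G"
    \<comment> \<open>Commuting with the point mass at \<open>inv x\<close>, evaluated at
      \<open>y\<close>, is exactly the required symmetry.\<close>
    have "ul {inv x} \<in> group_ring G" using xy by (auto simp: ul_def group_ring_def)
    hence "gr_mult G a (ul {inv x}) y = gr_mult G (ul {inv x}) a y" using c by simp
    thus "a (x \<otimes> y) = a (y \<otimes> x)"
      using xy by (simp add: gr_mult_delta_left gr_mult_delta_right)
  qed
qed

lemma class_functions_in_group_ring: "a \<in> class_functions G \<Longrightarrow> a \<in> group_ring G"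
  by (simp add: class_functions_def)

lemma gr_mult_class_functions:
  assumes "a \<in> class_functions G" "b \<in> class_functions G"
  shows "gr_mult G a b \<in> class_functions G"
proof -
  have "gr_mult G (gr_mult G a b) f = gr_mult G f (gr_mult G a b)" if "f \<in> group_ring G" for f
    using assms that class_functions_iff_central class_functions_in_group_ring
    by (metis gr_mult_assoc)
  thus ?thesis by (subst class_functions_iff_central) auto
qed

lemma gr_mult_one:
  assumes "f \<in> group_ring G"
  shows "gr_mult G (ul {\<one>}) f = f" "gr_mult G f (ul {\<one>}) = f"
proof -
  have "gr_mult G (ul {\<one>}) f g = f g" "gr_mult G f (ul {\<one>}) g = f g" for g
    using assms gr_mult_delta_left[of \<one> g f] gr_mult_delta_right[of \<one> g f]
    by (cases "g \<in> carrier G"; simp add: group_ring_def gr_mult_def)+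
  thus "gr_mult G (ul {\<one>}) f = f" "gr_mult G f (ul {\<one>}) = f" by auto
qed

lemma one_class_functions: "ul {\<one>} \<in> class_functions G"
proof -
  have "ul {\<one>} \<in> group_ring G" by (auto simp: ul_def group_ring_def)
  thus ?thesis by (subst class_functions_iff_central) (simp_all add: gr_mult_one)
qed

lemma comm_monoid_class_monoid: "comm_monoid (class_monoid G)"
  by (rule comm_monoidI)
    (auto simp: class_monoid_def gr_mult_class_functions one_class_functions gr_mult_assoc gr_mult_one
        dest: class_functions_in_group_ring class_functions_iff_central[THEN iffD1, rotated])

sublocale CF: comm_monoid "class_monoid G"
  rewrites "carrier (class_monoid G) = class_functions G"
    and "monoid.mult (class_monoid G) = gr_mult G"
    and "one (class_monoid G) = ul {\<one>}"
  by (rule comm_monoid_class_monoid) (simp_all add: class_monoid_def)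

abbreviation cpow :: "('a \<Rightarrow> int) \<Rightarrow> nat \<Rightarrow> ('a \<Rightarrow> int)" where
  "cpow a k \<equiv> a [^]\<^bsub>class_monoid G\<^esub> k"

lemma pow_cong:
  assumes "x \<in> carrier G" "[i = j] (mod int (order G))"
  shows "x [^] i = x [^] j"
proof -
  have "int (ord x) dvd int (order G)"
    using ord_dvd_group_order[OF assms(1)] by simp
  hence "int (ord x) dvd j - i"
    using assms(2) by (meson cong_iff_dvd_diff cong_sym dvd_trans)
  thus ?thesis using int_pow_eq[OF assms(1)] by simp
qed

lemma nat_pow_cong:
  fixes i j :: nat
  assumes "x \<in> carrier G" "[i = j] (mod order G)"
  shows "x [^] i = x [^] j"
  using pow_cong[OF assms(1), of "int i" "int j"] assms(2) by (simp add: cong_int_iff int_pow_int)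

lemma nat_pow_inverse:
  fixes u v :: nat
  assumes "x \<in> carrier G" "[u * v = 1] (mod order G)"
  shows "(x [^] u) [^] v = x"
  using nat_pow_cong[OF assms] assms(1) by (simp add: nat_pow_pow)

lemma order_pos: "order G > 0"
  unfolding order_def by (simp add: card_gt_0_iff, blast)

section \<open>Expansion of convolution powers over tuples\<close>

text \<open>The test function \<open>b\<close> must stay arbitrary: splitting off the first factor
  \<open>x\<close> replaces \<open>b\<close> by its translate by \<open>x\<close> in the induction
  step.\<close>

lemma sum_cpow:
  assumes "a \<in> class_functions G"
  shows "(\<Sum>g\<in>carrier G. cpow a k g * b g) =
    (\<Sum>xs | set xs \<subseteq> carrier G \<and> length xs = k. prod_list (map a xs) * b (foldr (\<otimes>) xs \<one>))"
proof (induction k arbitrary: b)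
  case 0
  have "(\<Sum>g\<in>carrier G. ul {\<one>} g * b g) = (\<Sum>g\<in>carrier G. if g = \<one> then b g else 0)"
    by (intro sum.cong) (auto simp: ul_def)
  moreover have "{xs. set xs \<subseteq> carrier G \<and> length xs = 0} = {[]}" by auto
  ultimately show ?case by (simp add: class_monoid_def)
next
  case (Suc k)
  let ?L = "{xs. set xs \<subseteq> carrier G \<and> length xs = k}"
  let ?w = "\<lambda>xs. prod_list (map a xs) * b (foldr (\<otimes>) xs \<one>)"
  have inj: "inj_on (\<lambda>(xs, n). n # xs) A" for A :: "('a list \<times> 'a) set"
    by (auto simp: inj_on_def)
  have "(\<Sum>g\<in>carrier G. cpow a (Suc k) g * b g) =
        (\<Sum>g\<in>carrier G. gr_mult G a (cpow a k) g * b g)"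
    using assms by (simp only: CF.nat_pow_Suc2)
  also have "\<dots> = (\<Sum>x\<in>carrier G. a x * (\<Sum>xs\<in>?L. prod_list (map a xs) * b (x \<otimes> foldr (\<otimes>) xs \<one>)))"
    by (simp add: sum_gr_mult Suc)
  also have "\<dots> = (\<Sum>x\<in>carrier G. \<Sum>xs\<in>?L. ?w (x # xs))"
    by (simp add: sum_distrib_left mult.assoc)
  also have "\<dots> = (\<Sum>xs\<in>?L. \<Sum>x\<in>carrier G. ?w (x # xs))"
    by (rule sum.swap)
  also have "\<dots> = sum ?w {xs. set xs \<subseteq> carrier G \<and> length xs = Suc k}"
    unfolding lists_length_Suc_eq sum.reindex[OF inj] by (simp add: sum.cartesian_product case_prod_unfold)
  finally show ?case .
qed

lemma foldr_mult_closed [simp]: "set xs \<subseteq> carrier G \<Longrightarrow> foldr (\<otimes>) xs \<one> \<in> carrier G"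
  by (induction xs) auto

lemma foldr_mult_snoc:
  "set xs \<subseteq> carrier G \<Longrightarrow> x \<in> carrier G \<Longrightarrow> foldr (\<otimes>) (xs @ [x]) \<one> = foldr (\<otimes>) xs \<one> \<otimes> x"
  by (induction xs) (auto simp: m_assoc)

lemma foldr_mult_replicate: "x \<in> carrier G \<Longrightarrow> foldr (\<otimes>) (replicate k x) \<one> = x [^] k"
  by (induction k) (simp, simp only: replicate_Suc foldr_Cons comp_apply nat_pow_Suc2)

text \<open>Rotating a tuple only conjugates its product, so the tuples that survive modulo \<open>p\<close> are
  the constant ones.\<close>
lemma sum_cpow_prime_cong:
  assumes a: "a \<in> class_functions G" and b: "b \<in> class_functions G" and p: "prime p"
  shows "[(\<Sum>g\<in>carrier G. cpow a p g * b g) = (\<Sum>x\<in>carrier G. a x ^ p * b (x [^] p))] (mod int p)"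
proof -
  let ?L = "{xs. set xs \<subseteq> carrier G \<and> length xs = p}"
  let ?w = "\<lambda>xs. prod_list (map a xs) * b (foldr (\<otimes>) xs \<one>)"
  have p0: "p \<noteq> 0" using p by auto
  have "[sum ?w ?L = sum ?w {xs \<in> ?L. rotate1 xs = xs}] (mod int p)"
  proof (rule sum_cong_fixed_points_mod_prime[OF _ p])
    show "finite ?L" by (rule finite_lists_length_eq) simp
    show "(rotate1 ^^ p) xs = xs" if "xs \<in> ?L" for xs
      using that rotate_id[of p xs] by (simp add: rotate_def)
    show "?w (rotate1 xs) = ?w xs" if "xs \<in> ?L" for xs
    proof (cases xs)
      case (Cons y ys)
      thus ?thesis using that b
        by (simp add: foldr_mult_snoc class_functions_def mult.commute del: foldr_append)
    qed simp
  qed auto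
  moreover have "{xs \<in> ?L. rotate1 xs = xs} = replicate p ` carrier G"
  proof safe
    fix xs assume xs: "set xs \<subseteq> carrier G" "p = length xs" "rotate1 xs = xs"
    then obtain x where "set xs = {x}"
      using rotate1_fixpoint_card[of xs] p0 by (auto simp: card_1_singleton_iff)
    hence "xs = replicate (length xs) x" "x \<in> carrier G"
      using xs(1) by (auto intro: replicate_eqI)
    thus "xs \<in> replicate (length xs) ` carrier G" by blast
  next
    fix x assume "x \<in> carrier G"
    show "rotate1 (replicate p x) = replicate p x" 
      by (cases p) (simp_all add: replicate_append_same)
  qed (use p0 in auto)
  moreover have "inj_on (replicate p) (carrier G)" using p0 by (auto simp: inj_on_def)
  ultimately show ?thesis
    by (simp add: sum_cpow[OF a] sum.reindex foldr_mult_replicate prod_list_replicate map_replicate del: foldr_replicate)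
qed

section \<open>Pullback along power maps\<close>

lemma pow_conj:
  "\<lbrakk>g \<in> carrier G; h \<in> carrier G\<rbrakk> \<Longrightarrow> (inv h \<otimes> g \<otimes> h) [^] (k::nat) = inv h \<otimes> g [^] k \<otimes> h"
  by (induction k) (auto simp: m_assoc)

lemma class_function_conj:
  assumes "a \<in> class_functions G" "g \<in> carrier G" "h \<in> carrier G"
  shows "a (inv h \<otimes> g \<otimes> h) = a g"
proof -
  have "a (inv h \<otimes> (g \<otimes> h)) = a (g \<otimes> h \<otimes> inv h)"
    using assms by (simp add: class_functions_def)
  thus ?thesis using assms by (simp add: m_assoc)
qed

section \<open>The congruence for prime convolution powers\<close>

text \<open>Test \<open>sum_cpow_prime_cong\<close> against a class function concentrated on the
  conjugates of \<open>g [^] p\<close>. Both sides then acquire the factor \<open>order G\<close>,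
  which is invertible modulo \<open>p\<close>, and Fermat's theorem removes the exponent from
  \<open>a g ^ p\<close>.\<close>

lemma cpow_prime_cong:
  assumes a: "a \<in> class_functions G" and p: "prime p" "\<not> p dvd order G" and g: "g \<in> carrier G"
  shows "[cpow a p (g [^] p) = a g] (mod int p)"
proof -
  \<comment> \<open>Summing over all conjugating elements \<open>h\<close>, with multiplicity, gives
    every pairing with a class function the same weight \<open>order G\<close>, whatever the size of
    the conjugacy class.\<close>
  define b where "b = (\<lambda>z. \<Sum>h\<in>carrier G. ul {inv h \<otimes> g [^] p \<otimes> h} z)"
  have delta: "(\<Sum>z\<in>carrier G. f z * ul {k} z) = f k" if "k \<in> carrier G" for f k
  proof -
    have "f z * ul {k} z = (if z = k then f z else 0)" for z by (simp add: ul_def)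
    thus ?thesis using that by simp
  qed
  have b: "b \<in> class_functions G"
    unfolding class_functions_def
  proof (intro CollectI conjI ballI)
    show "b \<in> group_ring G"
      using g by (auto simp: b_def group_ring_def ul_def intro!: sum.neutral)
    fix x y assume xy: "x \<in> carrier G" "y \<in> carrier G"
    \<comment> \<open>Conjugating by \<open>x\<close> matches the term for \<open>h\<close> at
      \<open>x \<otimes> y\<close> with the term for \<open>h \<otimes> x\<close> at
      \<open>y \<otimes> x\<close>; reindexing by right translation then shows that \<open>b\<close>
      is a class function.\<close>
    have "ul {inv h \<otimes> g [^] p \<otimes> h} (x \<otimes> y) = ul {inv (h \<otimes> x) \<otimes> g [^] p \<otimes> (h \<otimes> x)} (y \<otimes> x)"
      if "h \<in> carrier G" for h
    proof -
      let ?c = "inv h \<otimes> g [^] p \<otimes> h"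
      have c: "?c \<in> carrier G" using that g by simp
      have "inv (h \<otimes> x) \<otimes> g [^] p \<otimes> (h \<otimes> x) = inv x \<otimes> ?c \<otimes> x"
        using that g xy by (simp add: inv_mult_group m_assoc)
      also have "\<dots> = y \<otimes> x \<longleftrightarrow> inv x \<otimes> ?c = y"
        using c xy by simp
      also have "\<dots> \<longleftrightarrow> ?c = x \<otimes> y" using c xy inv_solve_left[of y x ?c] by auto
      finally show ?thesis unfolding ul_def singleton_iff by metis
    qed
    hence "b (x \<otimes> y) = (\<Sum>h\<in>carrier G. ul {inv (h \<otimes> x) \<otimes> g [^] p \<otimes> (h \<otimes> x)} (y \<otimes> x))"
      unfolding b_def by (intro sum.cong refl)
    also have "\<dots> = b (y \<otimes> x)"
      unfolding b_def by (rule sum_translate_right[OF xy(1)])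
    finally show "b (x \<otimes> y) = b (y \<otimes> x)" .
  qed
  have "(\<Sum>z\<in>carrier G. cpow a p z * b z) =
      (\<Sum>h\<in>carrier G. \<Sum>z\<in>carrier G. cpow a p z * ul {inv h \<otimes> g [^] p \<otimes> h} z)"
    unfolding b_def sum_distrib_left by (rule sum.swap)
  also have "\<dots> = (\<Sum>h\<in>carrier G. cpow a p (inv h \<otimes> g [^] p \<otimes> h))"
    using g by (intro sum.cong refl delta) auto
  also have "\<dots> = int (order G) * cpow a p (g [^] p)"
    using g a by (simp add: class_function_conj order_def)
  finally have L: "(\<Sum>z\<in>carrier G. cpow a p z * b z) = int (order G) * cpow a p (g [^] p)" .
  \<comment> \<open>As \<open>p\<close> is invertible modulo the order, the \<open>p\<close>-th
    power map is injective, so \<open>x [^] p\<close> equals a given conjugate of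
    \<open>g [^] p\<close> only when \<open>x\<close> is the corresponding conjugate of
    \<open>g\<close>.\<close>
  obtain v where v: "[p * v = 1] (mod order G)"
    using p cong_solve_coprime_nat[of p "order G"] prime_imp_coprime[of p "order G"] by auto
  have inj: "x [^] p = y [^] p \<longleftrightarrow> x = y" if "x \<in> carrier G" "y \<in> carrier G" for x y
    using nat_pow_inverse[OF _ v] that by metis
  have "(\<Sum>x\<in>carrier G. a x ^ p * b (x [^] p)) =
      (\<Sum>h\<in>carrier G. \<Sum>x\<in>carrier G. a x ^ p * ul {inv h \<otimes> g [^] p \<otimes> h} (x [^] p))"
    unfolding b_def sum_distrib_left by (rule sum.swap)
  also have "\<dots> = (\<Sum>h\<in>carrier G. \<Sum>x\<in>carrier G. a x ^ p * ul {inv h \<otimes> g \<otimes> h} x)"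
    using g by (intro sum.cong refl) (simp add: ul_def inj flip: pow_conj)
  also have "\<dots> = (\<Sum>h\<in>carrier G. a (inv h \<otimes> g \<otimes> h) ^ p)"
    using g by (intro sum.cong refl delta) auto
  also have "\<dots> = int (order G) * a g ^ p"
    using g a by (simp add: class_function_conj order_def)
  finally have R: "(\<Sum>x\<in>carrier G. a x ^ p * b (x [^] p)) = int (order G) * a g ^ p" .
  have "coprime (int (order G)) (int p)"
    using p prime_imp_coprime[of p "order G"] by (simp add: coprime_commute)
  hence "[cpow a p (g [^] p) = a g ^ p] (mod int p)"
    using sum_cpow_prime_cong[OF a b p(1)] unfolding L R by (simp add: cong_mult_lcancel)
  thus ?thesis using fermat_int[OF p(1)] cong_trans by blast
qed

text \<open>Apply the preceding congruence at \<open>g [^] v\<close>, whose \<open>p\<close>-th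
  power is \<open>g\<close>. Outside the carrier both sides vanish.\<close>

lemma cpow_prime_cong_pullback:
  assumes a: "a \<in> class_functions G" and p: "prime p" "[p * v = 1] (mod order G)"
  shows "[cpow a p g = power_pullback G v a g] (mod int p)"
proof (cases "g \<in> carrier G")
  case True
  have "\<not> p dvd order G"
  proof
    assume "p dvd order G"
    hence "[p * v = 1] (mod p)" using p(2) cong_dvd_modulus_nat by blast
    thus False using p(1) by (simp add: cong_def) 
  qed
  moreover have "(g [^] v) [^] p = g"
    using nat_pow_inverse[OF True, of v p] p(2) by (simp add: mult.commute)
  ultimately show ?thesis
    using cpow_prime_cong[OF a p(1), of "g [^] v"] True by (simp add: power_pullback_def)
next
  case False
  have "cpow a p \<in> group_ring G" using a by (simp add: class_functions_in_group_ring)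
  thus ?thesis using False by (simp add: power_pullback_def group_ring_def)
qed

lemma power_pullback_compose:
  "power_pullback G u (power_pullback G v a) = power_pullback G (u * v) a"
  by (auto simp: power_pullback_def nat_pow_pow)

lemma power_pullback_cong:
  "[u = v] (mod order G) \<Longrightarrow> power_pullback G u a = power_pullback G v a"
  by (simp add: power_pullback_def fun_eq_iff nat_pow_cong[of _ u v])

lemma power_pullback_1: "a \<in> group_ring G \<Longrightarrow> power_pullback G 1 a = a"
  by (auto simp: power_pullback_def group_ring_def)

lemma power_pullback_inverse:
  assumes "a \<in> group_ring G" "[u * v = 1] (mod order G)"
  shows "power_pullback G u (power_pullback G v a) = a"
  using power_pullback_compose power_pullback_cong[OF assms(2)] power_pullback_1[OF assms(1)] by metis

lemma power_pullback_class_functions: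
  assumes "a \<in> class_functions G"
  shows "power_pullback G v a \<in> class_functions G"
  unfolding class_functions_def
proof (intro CollectI conjI ballI)
  fix x y assume xy: "x \<in> carrier G" "y \<in> carrier G"
  \<comment> \<open>The two products are conjugate by \<open>x\<close>, and taking powers commutes
    with conjugation.\<close>
  have "(y \<otimes> x) [^] v = (inv x \<otimes> (x \<otimes> y) \<otimes> x) [^] v" using xy by (simp add: m_assoc)
  also have "\<dots> = inv x \<otimes> (x \<otimes> y) [^] v \<otimes> x" using xy by (intro pow_conj) auto
  finally show "power_pullback G v a (x \<otimes> y) = power_pullback G v a (y \<otimes> x)"
    using class_function_conj[OF assms, of "(x \<otimes> y) [^] v" x] xy by (simp add: power_pullback_def)
qed (simp add: group_ring_def power_pullback_def)

lemma abs_power_pullback_le: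
  "(\<And>g. \<bar>a g\<bar> \<le> A) \<Longrightarrow> \<bar>power_pullback G v a g\<bar> \<le> A"
  using order_trans[OF abs_ge_zero] by (auto simp: power_pullback_def)

lemma group_ring_bounded:
  assumes "a \<in> group_ring G"
  shows "\<bar>a g\<bar> \<le> (\<Sum>x\<in>carrier G. \<bar>a x\<bar>)"
proof (cases "g \<in> carrier G")
  case True
  thus ?thesis using member_le_sum[of g "carrier G" "\<lambda>x. \<bar>a x\<bar>"] by simp
next
  case False
  thus ?thesis using assms by (simp add: group_ring_def sum_nonneg)
qed

lemma abs_gr_mult_le:
  assumes "\<And>g. \<bar>a g\<bar> \<le> A" "\<And>g. \<bar>b g\<bar> \<le> B"
  shows "\<bar>gr_mult G a b g\<bar> \<le> int (order G) * (A * B)"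
proof -
  have AB: "0 \<le> A" "0 \<le> B" using assms order_trans[OF abs_ge_zero] by blast+
  show ?thesis
  proof (cases "g \<in> carrier G")
    case True
    have "\<bar>gr_mult G a b g\<bar> \<le> (\<Sum>x\<in>carrier G. \<bar>a x * b (inv x \<otimes> g)\<bar>)"
      using True by (simp add: gr_mult_def sum_abs)
    also have "\<dots> \<le> (\<Sum>x\<in>carrier G. A * B)"
      using assms AB by (intro sum_mono) (simp add: abs_mult mult_mono)
    finally show ?thesis by (simp add: order_def)
  qed (use AB in \<open>simp add: gr_mult_def\<close>)
qed

lemma gr_mult_cong:
  assumes "\<And>g. [a g = a' g] (mod k)" "\<And>g. [b g = b' g] (mod k)"
  shows "[gr_mult G a b g = gr_mult G a' b' g] (mod k)"
  using assms by (auto simp: gr_mult_def intro!: cong_sum cong_mult)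

section \<open>Multiplicativity of the pullback\<close>

text \<open>Modulo \<open>p\<close>, both sides are the \<open>p\<close>-th convolution power of the
  product, by commutativity. Both are bounded by \<open>order G * (A * B)\<close>, and
  \<open>p\<close> exceeds twice this bound, so they are equal.\<close>

lemma power_pullback_gr_mult_prime:
  assumes a: "a \<in> class_functions G" "\<And>g. \<bar>a g\<bar> \<le> A"
    and b: "b \<in> class_functions G" "\<And>g. \<bar>b g\<bar> \<le> B"
    and p: "prime p" "[p * v = 1] (mod order G)" "2 * (int (order G) * (A * B)) < int p"
  shows "power_pullback G v (gr_mult G a b) =
    gr_mult G (power_pullback G v a) (power_pullback G v b)"
proof
  fix g
  have "cpow (gr_mult G a b) p = gr_mult G (cpow a p) (cpow b p)"
    using CF.nat_pow_distrib[of a b p] a b by simp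
  hence "[power_pullback G v (gr_mult G a b) g = gr_mult G (cpow a p) (cpow b p) g] (mod int p)"
    using cpow_prime_cong_pullback[OF gr_mult_class_functions[OF a(1) b(1)] p(1,2), of g]
    by (simp add: cong_sym_eq)
  also have "[gr_mult G (cpow a p) (cpow b p) g =
      gr_mult G (power_pullback G v a) (power_pullback G v b) g] (mod int p)"
    by (intro gr_mult_cong cpow_prime_cong_pullback a b p)
  finally show "power_pullback G v (gr_mult G a b) g =
      gr_mult G (power_pullback G v a) (power_pullback G v b) g"
    using p(3) a b
    by (elim cong_imp_eq_of_abs_less) (auto intro!: abs_power_pullback_le abs_gr_mult_le)
qed

lemma power_pullback_gr_mult:
  assumes a: "a \<in> class_functions G" and b: "b \<in> class_functions G" and u: "coprime u (order G)"
  shows "power_pullback G u (gr_mult G a b) =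
    gr_mult G (power_pullback G u a) (power_pullback G u b)"
proof -
  obtain A B where AB: "\<And>g. \<bar>a g\<bar> \<le> A" "\<And>g. \<bar>b g\<bar> \<le> B"
    using group_ring_bounded a b class_functions_in_group_ring by metis
  \<comment> \<open>Quantifying over all class functions within the bounds \<open>A\<close> and
    \<open>B\<close> fixes one threshold for the primes. Pullbacks respect these bounds, so
    \<open>Q\<close> is closed under products of exponents.\<close>
  define Q where "Q u \<longleftrightarrow> (\<forall>a\<in>class_functions G. \<forall>b\<in>class_functions G.
    (\<forall>g. \<bar>a g\<bar> \<le> A) \<longrightarrow> (\<forall>g. \<bar>b g\<bar> \<le> B) \<longrightarrow>
    power_pullback G u (gr_mult G a b) = gr_mult G (power_pullback G u a) (power_pullback G u b))" for u
  have "Q u"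
  proof (rule large_prime_induct[OF order_pos u, of Q "nat (2 * (int (order G) * (A * B)))"])
    show "Q 1"
      unfolding Q_def by (simp add: power_pullback_1[unfolded One_nat_def] class_functions_in_group_ring)
    show "Q v" if "[u = v] (mod order G)" "Q u" for u v
      using that(2) unfolding Q_def power_pullback_cong[OF that(1)] .
    show "Q (u * v)" if "Q u" "Q v" for u v
      using that unfolding Q_def
      by (auto simp: power_pullback_class_functions abs_power_pullback_le simp flip: power_pullback_compose)
    show "Q v" if "prime p" "nat (2 * (int (order G) * (A * B))) < p" "[p * v = 1] (mod order G)" for p v
      unfolding Q_def using that by (auto intro!: power_pullback_gr_mult_prime)
  qed
  thus ?thesis using a b AB by (simp add: Q_def)
qed

section \<open>Central S-rings\<close>

text \<open>Since the basic sets are disjoint, the coefficient of \<open>X\<close> in a combination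
  is its value at any point of \<open>X\<close>. Membership in the S-ring thus becomes a pointwise
  condition, which can be tested modulo \<open>p\<close>.\<close>

lemma zspan_iff:
  assumes "schur_partition G S"
  shows "f \<in> zspan S \<longleftrightarrow> f \<in> group_ring G \<and> (\<forall>X\<in>S. \<forall>x\<in>X. \<forall>y\<in>X. f x = f y)"
proof -
  have un: "\<Union>S = carrier G" and disj: "\<And>X Y g. X \<in> S \<Longrightarrow> Y \<in> S \<Longrightarrow> g \<in> X \<Longrightarrow> g \<in> Y \<Longrightarrow> X = Y"
    using assms unfolding schur_partition_def by auto
  have "finite S"
    using un by (intro finite_subset[of S "Pow (carrier G)"]) auto
  have eval: "(\<Sum>Y\<in>S. c Y * ul Y g) = c X" if "X \<in> S" "g \<in> X" for c :: "'a set \<Rightarrow> int" and X g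
  proof -
    have "(\<Sum>Y\<in>S. c Y * ul Y g) = (\<Sum>Y\<in>S. if Y = X then c Y else 0)"
      using that disj by (intro sum.cong) (auto simp: ul_def)
    thus ?thesis using \<open>finite S\<close> that by simp
  qed
  have out: "(\<Sum>Y\<in>S. c Y * ul Y g) = 0" if "g \<notin> carrier G" for c :: "'a set \<Rightarrow> int" and g
    using that un by (intro sum.neutral) (auto simp: ul_def)
  show ?thesis
  proof safe
    assume "f \<in> zspan S"
    then obtain c where c: "f = (\<lambda>g. \<Sum>X\<in>S. c X * ul X g)" by (auto simp: zspan_def)
    show "f \<in> group_ring G" unfolding c group_ring_def using out by blast
    show "f x = f y" if "X \<in> S" "x \<in> X" "y \<in> X" for X x y
      unfolding c using that by (simp add: eval)
  next
    assume f: "f \<in> group_ring G" "\<forall>X\<in>S. \<forall>x\<in>X. \<forall>y\<in>X. f x = f y"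
    define c where "c X = f (SOME x. x \<in> X)" for X
    have "f g = (\<Sum>X\<in>S. c X * ul X g)" for g
    proof (cases "g \<in> carrier G")
      case True
      then obtain X where X: "X \<in> S" "g \<in> X" using un by blast
      hence "c X = f g" using f(2) someI[of "\<lambda>x. x \<in> X" g] unfolding c_def by blast
      thus ?thesis using eval[OF X] by simp
    next
      case False
      thus ?thesis using f(1) out by (simp add: group_ring_def)
    qed
    thus "f \<in> zspan S" unfolding zspan_def by blast
  qed
qed

lemma zspan_class_functions:
  assumes "schur_partition G S" "central_sring G S" "a \<in> zspan S"
  shows "a \<in> class_functions G"
proof -
  have "a \<in> group_ring G" using assms(1,3) zspan_iff by blast
  thus ?thesis using assms(2,3) class_functions_iff_central unfolding central_sring_def by blast
qed

lemma cpow_zspan: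
  assumes "schur_partition G S" "central_sring G S" "a \<in> zspan S"
  shows "cpow a k \<in> zspan S"
proof (induction k)
  case 0
  then show ?case using assms(1) by (simp add: schur_partition_def class_monoid_def)
next
  case (Suc k)
  then show ?case using assms by (simp add: schur_partition_def class_monoid_def)
qed

section \<open>Invariance of the S-ring under power maps\<close>

text \<open>For a large prime, the convolution power \<open>cpow b p\<close> lies in the S-ring and
  so is constant on basic sets. The pullback agrees with it modulo \<open>p\<close> and has values
  bounded by \<open>A\<close>, so it is constant on them too.\<close>

lemma power_pullback_zspan:
  assumes S: "schur_partition G S" "central_sring G S" and a: "a \<in> zspan S"
    and u: "coprime u (order G)"
  shows "power_pullback G u a \<in> zspan S"
proof -
  obtain A where A: "\<And>g. \<bar>a g\<bar> \<le> A"
    using group_ring_bounded a zspan_iff[OF S(1)] by metis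
  \<comment> \<open>As \<open>A\<close> also bounds every pullback, one threshold
    \<open>2 * A\<close> serves for all primes that are composed.\<close>
  define Q where "Q u \<longleftrightarrow>
    (\<forall>a\<in>zspan S. (\<forall>g. \<bar>a g\<bar> \<le> A) \<longrightarrow> power_pullback G u a \<in> zspan S)" for u
  have "Q u"
  proof (rule large_prime_induct[OF order_pos u, of Q "nat (2 * A)"])
    show "Q 1"
      unfolding Q_def using zspan_iff[OF S(1)]
      by (metis power_pullback_1)
    show "Q v" if "[u = v] (mod order G)" "Q u" for u v
      using that(2) unfolding Q_def power_pullback_cong[OF that(1)] .
    show "Q (u * v)" if "Q u" "Q v" for u v
      using that unfolding Q_def
      by (auto simp: abs_power_pullback_le simp flip: power_pullback_compose)
    show "Q v" if p: "prime p" "nat (2 * A) < p" "[p * v = 1] (mod order G)" for p v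
      unfolding Q_def zspan_iff[OF S(1), of "power_pullback _ _ _"]
    proof (intro ballI impI conjI)
      fix b X x y
      assume b: "b \<in> zspan S" "\<forall>g. \<bar>b g\<bar> \<le> A" and X: "X \<in> S" "x \<in> X" "y \<in> X"
      note cong = cpow_prime_cong_pullback[OF zspan_class_functions[OF S b(1)] p(1,3)]
      have "cpow b p x = cpow b p y"
        using cpow_zspan[OF S b(1)] X zspan_iff[OF S(1)] by blast
      hence "[power_pullback G v b x = power_pullback G v b y] (mod int p)"
        using cong[of x] cong[of y] by (metis cong_sym cong_trans)
      thus "power_pullback G v b x = power_pullback G v b y"
        by (rule cong_imp_eq_of_abs_less) (use b p in \<open>auto intro!: abs_power_pullback_le\<close>)
    qed (simp add: group_ring_def power_pullback_def)
  qed
  thus ?thesis using a A by (simp add: Q_def)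
qed

text \<open>The exponents \<open>u\<close> and \<open>v\<close> give mutually inverse maps on
  \<open>G\<close>, so a preimage under one is an image under the other.\<close>

lemma power_pullback_ul:
  assumes "X \<subseteq> carrier G" "[u * v = 1] (mod order G)"
  shows "power_pullback G u (ul X) = ul ((\<lambda>x. x [^] v) ` X)"
proof
  fix g
  have "g [^] u \<in> X \<longleftrightarrow> g \<in> (\<lambda>x. x [^] v) ` X" if "g \<in> carrier G"
  proof
    assume "g [^] u \<in> X"
    moreover have "g = (g [^] u) [^] v" using nat_pow_inverse[OF that assms(2)] by simp
    ultimately show "g \<in> (\<lambda>x. x [^] v) ` X" by blast
  next
    assume "g \<in> (\<lambda>x. x [^] v) ` X"
    then obtain x where "x \<in> X" "g = x [^] v" by blast
    thus "g [^] u \<in> X" 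
      using nat_pow_inverse[of x v u] assms by (auto simp: mult.commute)
  qed
  moreover have "(\<lambda>x. x [^] v) ` X \<subseteq> carrier G" using assms(1) by auto
  ultimately show "power_pullback G u (ul X) g = ul ((\<lambda>x. x [^] v) ` X) g"
    by (auto simp: power_pullback_def ul_def)
qed

text \<open>Images of basic sets under both power maps are unions of basic sets. Minimality of basic
  sets, used once for each direction, makes the image a single basic set.\<close>

lemma power_image_basic_set:
  assumes S: "schur_partition G S" "central_sring G S" and X: "X \<in> S"
    and uv: "[u * v = 1] (mod order G)"
  shows "(\<lambda>x. x [^] v) ` X \<in> S"
proof -
  have un: "\<Union>S = carrier G" and ne: "{} \<notin> S"
    and disj: "\<And>X Y g. X \<in> S \<Longrightarrow> Y \<in> S \<Longrightarrow> g \<in> X \<Longrightarrow> g \<in> Y \<Longrightarrow> X = Y"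
    using S unfolding schur_partition_def by auto
  have vu: "[v * u = 1] (mod order G)" using uv by (simp add: mult.commute)
  have "coprime u (order G)" "coprime v (order G)"
    using uv vu coprime_iff_invertible_nat by (metis One_nat_def)+
  hence image_zspan: "ul ((\<lambda>x. x [^] v) ` Z) \<in> zspan S" "ul ((\<lambda>x. x [^] u) ` Z) \<in> zspan S"
    if "Z \<in> S" for Z
  proof -
    have sub: "Z \<subseteq> carrier G" using that un by blast
    have "ul Z \<in> zspan S"
      using that sub disj unfolding zspan_iff[OF S(1)] by (auto simp: ul_def group_ring_def)
    thus "ul ((\<lambda>x. x [^] v) ` Z) \<in> zspan S" "ul ((\<lambda>x. x [^] u) ` Z) \<in> zspan S"
      using power_pullback_zspan[OF S] \<open>coprime u (order G)\<close> \<open>coprime v (order G)\<close>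
        power_pullback_ul[OF sub uv] power_pullback_ul[OF sub vu] by metis+
  qed
  have union: "Y \<subseteq> Z" if "ul Z \<in> zspan S" "Y \<in> S" "y \<in> Y" "y \<in> Z" for Y Z y
  proof
    fix z assume "z \<in> Y"
    hence "ul Z z = ul Z y" using that unfolding zspan_iff[OF S(1)] by blast
    thus "z \<in> Z" using that(4) by (simp add: ul_def split: if_splits)
  qed
  have XG: "X \<subseteq> carrier G" using X un by blast
  have "X \<noteq> {}" using X ne by metis
  then obtain x where x: "x \<in> X" by blast
  then obtain Y where Y: "Y \<in> S" "x [^] v \<in> Y" using XG un by blast
  have "Y \<subseteq> (\<lambda>x. x [^] v) ` X"
    using union[OF image_zspan(1)[OF X] Y] x by blast
  \<comment> \<open>The image of \<open>Y\<close> under the \<open>u\<close>-th power contains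
    \<open>x\<close>, hence all of \<open>X\<close>; applying the \<open>v\<close>-th power gives
    the inclusion of the image of \<open>X\<close> in \<open>Y\<close>.\<close>
  moreover have "X \<subseteq> (\<lambda>x. x [^] u) ` Y"
    using union[OF image_zspan(2)[OF Y(1)] X x] Y(2) nat_pow_inverse[OF _ vu, of x] x XG
    by (metis image_eqI subsetD)
  hence "(\<lambda>x. x [^] v) ` X \<subseteq> (\<lambda>y. (y [^] u) [^] v) ` Y" by auto
  moreover have "(\<lambda>y. (y [^] u) [^] v) ` Y = (\<lambda>y. y) ` Y"
    using nat_pow_inverse[OF _ uv] Y(1) un by (intro image_cong) auto
  ultimately show ?thesis using Y(1) by simp
qed

end

section \<open>Power maps as automorphisms of a central S-ring\<close>

theorem theorem1p2:
  fixes G :: "('a, 'b) monoid_scheme" and S :: "'a set set" and m :: int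
  assumes "group G" and "finite (carrier G)"
    and "schur_partition G S" and "central_sring G S"
    and "coprime m (int (card (carrier G)))"
  shows "(\<forall>X\<in>S. (\<lambda>x. x [^]\<^bsub>G\<^esub> m) ` X \<in> S) \<and>
    (\<exists>\<phi>. (\<forall>X\<in>S. \<phi> (ul X) = ul ((\<lambda>x. x [^]\<^bsub>G\<^esub> m) ` X)) \<and>
         (\<forall>a\<in>zspan S. \<forall>b\<in>zspan S. \<forall>k l :: int.
             \<phi> (\<lambda>g. k * a g + l * b g) = (\<lambda>g. k * \<phi> a g + l * \<phi> b g)) \<and>
         bij_betw \<phi> (zspan S) (zspan S) \<and>
         (\<forall>a\<in>zspan S. \<forall>b\<in>zspan S. \<phi> (gr_mult G a b) = gr_mult G (\<phi> a) (\<phi> b)) \<and>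
         \<phi> (ul {\<one>\<^bsub>G\<^esub>}) = ul {\<one>\<^bsub>G\<^esub>})"
proof -
  interpret fin_group G
    using assms(1,2) by (simp add: fin_group_def fin_group_axioms_def)
  \<comment> \<open>Replacing \<open>m\<close> by its residue passes to a natural exponent with the
    same power map on \<open>G\<close>.\<close>
  define v where "v = nat (m mod int (order G))"
  have v: "int v = m mod int (order G)"
    using order_pos by (simp add: v_def)
  hence m: "[m = int v] (mod int (order G))" by simp
  have "coprime v (order G)"
    using assms(5) cong_imp_coprime[OF m] by (simp add: order_def)
  then obtain u where vu: "[v * u = 1] (mod order G)"
    using cong_solve_coprime_nat by auto
  hence uv: "[u * v = 1] (mod order G)" by (simp add: mult.commute)
  have cop: "coprime u (order G)" "coprime v (order G)"
    using uv vu coprime_iff_invertible_nat by (metis One_nat_def)+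
  have sub: "X \<subseteq> carrier G" if "X \<in> S" for X
    using that assms(3) by (auto simp: schur_partition_def)
  have img: "(\<lambda>x. x [^]\<^bsub>G\<^esub> m) ` X = (\<lambda>x. x [^]\<^bsub>G\<^esub> v) ` X" if "X \<in> S" for X
  proof (rule image_cong[OF refl])
    fix x assume "x \<in> X"
    thus "x [^]\<^bsub>G\<^esub> m = x [^]\<^bsub>G\<^esub> v"
      using pow_cong[OF _ m] sub[OF that] by (auto simp: int_pow_int)
  qed
  let ?\<phi> = "power_pullback G u"
  have closed: "power_pullback G w a \<in> zspan S" if "a \<in> zspan S" "coprime w (order G)" for a w
    using power_pullback_zspan[OF assms(3,4) that] .
  have ring: "a \<in> group_ring G" if "a \<in> zspan S" for a
    using that zspan_iff[OF assms(3)] by blast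
  show ?thesis
  proof (intro conjI exI[of _ ?\<phi>] ballI allI)
    show "(\<lambda>x. x [^]\<^bsub>G\<^esub> m) ` X \<in> S" if "X \<in> S" for X
      using power_image_basic_set[OF assms(3,4) that uv] img[OF that] by simp
    show "?\<phi> (ul X) = ul ((\<lambda>x. x [^]\<^bsub>G\<^esub> m) ` X)" if "X \<in> S" for X
      using power_pullback_ul[OF sub[OF that] uv] img[OF that] by simp
    show "?\<phi> (\<lambda>g. k * a g + l * b g) = (\<lambda>g. k * ?\<phi> a g + l * ?\<phi> b g)" for a b k l
      by (auto simp: power_pullback_def)
    show "bij_betw ?\<phi> (zspan S) (zspan S)"
      by (rule bij_betw_byWitness[where f' = "power_pullback G v"])
        (use closed cop ring power_pullback_inverse uv vu in auto)
    show "?\<phi> (gr_mult G a b) = gr_mult G (?\<phi> a) (?\<phi> b)" if "a \<in> zspan S" "b \<in> zspan S" for a b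
      using that zspan_class_functions[OF assms(3,4)] cop(1) by (intro power_pullback_gr_mult) auto
    show "?\<phi> (ul {\<one>\<^bsub>G\<^esub>}) = ul {\<one>\<^bsub>G\<^esub>}"
      using power_pullback_ul[OF _ uv, of "{\<one>\<^bsub>G\<^esub>}"] by simp
  qed
qed

end
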